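(* Let $\Upsilon_1,\Upsilon_2$ be sets of positions with $\mathcal{M}_{\mathrm{cl}(\Upsilon_1)}\cong\mathcal{M}_{\mathrm{cl}(\Upsilon_2)}\cong\mathcal{M}_{\mathrm{cl}( * )}$, let $\mathscr{Q}_k:\mathrm{cl}(\Upsilon_k)\to\mathcal{M}_{\mathrm{cl}(\Upsilon_k)}$ ($k=1,2$) be the canonical quotient maps and $\varphi_k:\mathcal{M}_{\mathrm{cl}(\Upsilon_k)}\to\mathcal{M}_{\mathrm{cl}( * )}$ misère monoid isomorphisms. Then for all $\xi_1\in\mathrm{cl}(\Upsilon_1)$, $\xi_2\in\mathrm{cl}(\Upsilon_2)$: (1) $o^-(\xi_1+\xi_2)\in\{\mathcal{N},\mathcal{P}\}$; (2) $o^-(\xi_1+\xi_2)=o^-\big(\varphi_1(\mathscr{Q}_1(\xi_1))\cdot\varphi_2(\mathscr{Q}_2(\xi_2))\big)$, where $\cdot$ is the operation of $\mathcal{M}_{\mathrm{cl}( * )}$ and $o^-$ of an element of $\mathcal{M}_{\mathrm{cl}( * )}$ is its outcome label.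
   Context: A position $\xi=\{\xi^L \mid \xi^R\}$ is given recursively by finite sets of Left and Right options. $0=\{\cdot\mid\cdot\}$, $*=\{0\mid 0\}$. Disjunctive sum: $\alpha+\beta=\{\alpha^L+\beta,\alpha+\beta^L \mid \alpha^R+\beta,\alpha+\beta^R\}$. Under misère play a player unable to move on their turn wins; $o^-(\xi)\in\{\mathcal{L},\mathcal{R},\mathcal{N},\mathcal{P}\}$ is the misère outcome (Left wins always / Right wins always / next player wins / next player loses). $\mathrm{cl}(\Upsilon)$ is the smallest set containing $\Upsilon$ closed under disjunctive sum and taking options. For closed $\Gamma$, $\alpha\equiv\beta\pmod\Gamma$ iff $o^-(\alpha+\gamma)=o^-(\beta+\gamma)$ for all $\gamma\in\Gamma$; the misère monoid $\mathcal{M}_\Gamma$ is the quotient monoid (operation induced by $+$, identity the class of $0$) with each class labelled by its members' misère outcome; the canonical quotient map sends a position to its class. Isomorphism of misère monoids means a monoid isomorphism which with its inverse preserves outcomes. $\mathcal{M}_{\mathrm{cl}( * )}=\{1,a\}$, $a^2=1$, $1$ of outcome $\mathcal{N}$, $a$ of outcome $\mathcal{P}$. *)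

theory Defs
  imports "HOL-Algebra.Group" "HOL-Library.FSet"
begin

datatype player = Left | Right

fun opponent :: "player \<Rightarrow> player" where
  "opponent Left = Right"
| "opponent Right = Left"

text \<open>\<open>Position A B\<close> is $\{A \mid B\}$; two positions are identical iff they have the same
  sets of Left options and of Right options.\<close>

datatype position = Position (left_opts: "position fset") (right_opts: "position fset")

fun opts :: "player \<Rightarrow> position \<Rightarrow> position fset" where
  "opts Left \<xi> = left_opts \<xi>"
| "opts Right \<xi> = right_opts \<xi>"

lemma size_opts: "\<eta> |\<in>| opts p \<xi> \<Longrightarrow> size \<eta> < size \<xi>"
proof -
  have aux: "size \<eta> < Suc (size_fset size A)" if "\<eta> |\<in>| A" for A :: "position fset"
  proof -
    have "Suc (size \<eta>) \<le> (\<Sum>x\<in>fset A. Suc (size x))"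
      using that by (intro member_le_sum) auto
    then show ?thesis by simp
  qed
  assume "\<eta> |\<in>| opts p \<xi>"
  then show ?thesis
    by (cases \<xi>; cases p) (auto dest!: aux)
qed

lemma size_left_opts [termination_simp]: "\<eta> |\<in>| left_opts \<xi> \<Longrightarrow> size \<eta> < size \<xi>"
  and size_right_opts [termination_simp]: "\<eta> |\<in>| right_opts \<xi> \<Longrightarrow> size \<eta> < size \<xi>"
  using size_opts[of \<eta> Left \<xi>] size_opts[of \<eta> Right \<xi>] by simp_all

instantiation position :: comm_monoid_add
begin

definition zero_position :: position where
  "0 = Position {||} {||}"

function plus_position :: "position \<Rightarrow> position \<Rightarrow> position" where
  "plus_position \<alpha> \<beta> = Position
     ((\<lambda>\<alpha>'. plus_position \<alpha>' \<beta>) |`| left_opts \<alpha> |\<union>| (\<lambda>\<beta>'. plus_position \<alpha> \<beta>') |`| left_opts \<beta>)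
     ((\<lambda>\<alpha>'. plus_position \<alpha>' \<beta>) |`| right_opts \<alpha> |\<union>| (\<lambda>\<beta>'. plus_position \<alpha> \<beta>') |`| right_opts \<beta>)"
  by pat_completeness auto
termination
  by (relation "measure (\<lambda>(\<alpha>, \<beta>). size \<alpha> + size \<beta>)") (auto simp: termination_simp)

declare plus_position.simps [simp del]

lemma left_opts_plus:
  "left_opts (\<alpha> + \<beta>) = (\<lambda>\<alpha>'. \<alpha>' + \<beta>) |`| left_opts \<alpha> |\<union>| (\<lambda>\<beta>'. \<alpha> + \<beta>') |`| left_opts \<beta>"
  for \<alpha> \<beta> :: position
  by (subst plus_position.simps) simp

lemma right_opts_plus:
  "right_opts (\<alpha> + \<beta>) = (\<lambda>\<alpha>'. \<alpha>' + \<beta>) |`| right_opts \<alpha> |\<union>| (\<lambda>\<beta>'. \<alpha> + \<beta>') |`| right_opts \<beta>"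
  for \<alpha> \<beta> :: position
  by (subst plus_position.simps) simp

instance
proof
  fix \<alpha> \<beta> \<gamma> :: position
  show "\<alpha> + \<beta> + \<gamma> = \<alpha> + (\<beta> + \<gamma>)"
  proof (induction "size \<alpha> + size \<beta> + size \<gamma>" arbitrary: \<alpha> \<beta> \<gamma> rule: less_induct)
    case less
    have A: "\<alpha>' + \<beta> + \<gamma> = \<alpha>' + (\<beta> + \<gamma>)"
      if "\<alpha>' |\<in>| left_opts \<alpha> \<or> \<alpha>' |\<in>| right_opts \<alpha>" for \<alpha>'
      using that by (intro less) (auto dest: size_left_opts size_right_opts)
    have B: "\<alpha> + \<beta>' + \<gamma> = \<alpha> + (\<beta>' + \<gamma>)"
      if "\<beta>' |\<in>| left_opts \<beta> \<or> \<beta>' |\<in>| right_opts \<beta>" for \<beta>'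
      using that by (intro less) (auto dest: size_left_opts size_right_opts)
    have C: "\<alpha> + \<beta> + \<gamma>' = \<alpha> + (\<beta> + \<gamma>')"
      if "\<gamma>' |\<in>| left_opts \<gamma> \<or> \<gamma>' |\<in>| right_opts \<gamma>" for \<gamma>'
      using that by (intro less) (auto dest: size_left_opts size_right_opts)
    show ?case
      by (rule position.expand)
        (simp add: fset_inject [symmetric] left_opts_plus right_opts_plus image_Un image_image
          Un_assoc A B C cong: image_cong)
  qed
  show "\<alpha> + \<beta> = \<beta> + \<alpha>"
  proof (induction "size \<alpha> + size \<beta>" arbitrary: \<alpha> \<beta> rule: less_induct)
    case less
    have A: "\<alpha>' + \<beta> = \<beta> + \<alpha>'"
      if "\<alpha>' |\<in>| left_opts \<alpha> \<or> \<alpha>' |\<in>| right_opts \<alpha>" for \<alpha>'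
      using that by (intro less) (auto dest: size_left_opts size_right_opts)
    have B: "\<alpha> + \<beta>' = \<beta>' + \<alpha>"
      if "\<beta>' |\<in>| left_opts \<beta> \<or> \<beta>' |\<in>| right_opts \<beta>" for \<beta>'
      using that by (intro less) (auto dest: size_left_opts size_right_opts)
    show ?case
      by (rule position.expand)
        (simp add: fset_inject [symmetric] left_opts_plus right_opts_plus image_Un image_image
          A B Un_commute cong: image_cong)
  qed
  show "0 + \<alpha> = \<alpha>"
  proof (induction "size \<alpha>" arbitrary: \<alpha> rule: less_induct)
    case less
    have Z: "left_opts 0 = {||}" "right_opts 0 = {||}"
      by (simp_all add: zero_position_def)
    have A: "0 + \<alpha>' = \<alpha>'"
      if "\<alpha>' |\<in>| left_opts \<alpha> \<or> \<alpha>' |\<in>| right_opts \<alpha>" for \<alpha>'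
      using that by (intro less) (auto dest: size_left_opts size_right_opts)
    show ?case
      by (rule position.expand)
        (simp add: fset_inject [symmetric] left_opts_plus right_opts_plus image_Un image_image
          A Z cong: image_cong)
  qed
qed

end

definition star :: position where
  "star = Position {|0|} {|0|}"

text \<open>\<open>wins_first p \<xi>\<close>: player \<open>p\<close>, to move in \<open>\<xi>\<close>, wins under misere play. Play always ends
  and has no draws, so \<open>p\<close> wins moving second iff the opponent does not win moving first.\<close>

function wins_first :: "player \<Rightarrow> position \<Rightarrow> bool" where
  "wins_first p \<xi> \<longleftrightarrow>
     opts p \<xi> = {||} \<or> (\<exists>\<eta>\<in>fset (opts p \<xi>). \<not> wins_first (opponent p) \<eta>)"
  by pat_completeness auto
termination
  by (relation "measure (\<lambda>(p, \<xi>). size \<xi>)") (auto intro: size_opts)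

declare wins_first.simps [simp del]

text \<open>The outcomes $\mathcal{L}$, $\mathcal{R}$, $\mathcal{N}$, $\mathcal{P}$.\<close>

datatype outcome = LeftWins | RightWins | NextWins | PreviousWins

definition misere_outcome :: "position \<Rightarrow> outcome" where
  "misere_outcome \<xi> =
     (if wins_first Left \<xi>
      then (if wins_first Right \<xi> then NextWins else LeftWins)
      else (if wins_first Right \<xi> then RightWins else PreviousWins))"

inductive_set cl :: "position set \<Rightarrow> position set" for \<Upsilon> where
  base: "\<xi> \<in> \<Upsilon> \<Longrightarrow> \<xi> \<in> cl \<Upsilon>"
| plus: "\<alpha> \<in> cl \<Upsilon> \<Longrightarrow> \<beta> \<in> cl \<Upsilon> \<Longrightarrow> \<alpha> + \<beta> \<in> cl \<Upsilon>"
| opts: "\<xi> \<in> cl \<Upsilon> \<Longrightarrow> \<eta> |\<in>| opts p \<xi> \<Longrightarrow> \<eta> \<in> cl \<Upsilon>"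

definition misere_equiv :: "position set \<Rightarrow> (position \<times> position) set" where
  "misere_equiv \<Gamma> = {(\<alpha>, \<beta>). \<alpha> \<in> \<Gamma> \<and> \<beta> \<in> \<Gamma> \<and>
     (\<forall>\<gamma>\<in>\<Gamma>. misere_outcome (\<alpha> + \<gamma>) = misere_outcome (\<beta> + \<gamma>))}"

definition quotient_map :: "position set \<Rightarrow> position \<Rightarrow> position set" where
  "quotient_map \<Gamma> \<xi> = misere_equiv \<Gamma> `` {\<xi>}"

record 'a misere_monoid = "'a monoid" +
  outcome_label :: "'a \<Rightarrow> outcome"

text \<open>The operation and the labels do not depend on representatives; see
  \<open>misere_monoid_mult\<close> and \<open>misere_monoid_label\<close> below.\<close>

definition misere_monoid_of :: "position set \<Rightarrow> position set misere_monoid" where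
  "misere_monoid_of \<Gamma> =
     \<lparr>carrier = \<Gamma> // misere_equiv \<Gamma>,
      monoid.mult = (\<lambda>X Y. \<Union>\<alpha>\<in>X. \<Union>\<beta>\<in>Y. quotient_map \<Gamma> (\<alpha> + \<beta>)),
      one = quotient_map \<Gamma> 0,
      outcome_label = (\<lambda>X. the_elem (misere_outcome ` X))\<rparr>"

definition misere_iso ::
  "('a, 'c) misere_monoid_scheme \<Rightarrow> ('b, 'd) misere_monoid_scheme \<Rightarrow> ('a \<Rightarrow> 'b) set" where
  "misere_iso M N = {\<phi>. \<phi> \<in> iso M N \<and> \<phi> \<one>\<^bsub>M\<^esub> = \<one>\<^bsub>N\<^esub> \<and>
     (\<forall>x\<in>carrier M. outcome_label N (\<phi> x) = outcome_label M x) \<and>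
     (\<forall>y\<in>carrier N. outcome_label M (inv_into (carrier M) \<phi> y) = outcome_label N y)}"

definition misere_isomorphic ::
  "('a, 'c) misere_monoid_scheme \<Rightarrow> ('b, 'd) misere_monoid_scheme \<Rightarrow> bool" where
  "misere_isomorphic M N \<longleftrightarrow> misere_iso M N \<noteq> {}"

lemma equiv_misere_equiv: "equiv \<Gamma> (misere_equiv \<Gamma>)"
  by (rule equivI) (auto simp: misere_equiv_def refl_on_def sym_def trans_def)

lemma zero_in_cl:
  assumes "\<xi> \<in> cl \<Upsilon>"
  shows "0 \<in> cl \<Upsilon>"
  using assms
proof (induction "size \<xi>" arbitrary: \<xi> rule: less_induct)
  case less
  show ?case
  proof (cases "\<xi> = 0")
    case False
    then obtain p \<eta> where \<eta>: "\<eta> |\<in>| opts p \<xi>"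
      by (metis opts.simps fempty_iff fset_eqI position.collapse zero_position_def)
    with less show ?thesis
      using size_opts cl.opts by blast
  qed (use less in simp)
qed

lemma misere_equiv_plus:
  assumes "(\<alpha>, \<alpha>') \<in> misere_equiv (cl \<Upsilon>)" "(\<beta>, \<beta>') \<in> misere_equiv (cl \<Upsilon>)"
  shows "(\<alpha> + \<beta>, \<alpha>' + \<beta>') \<in> misere_equiv (cl \<Upsilon>)"
proof -
  have in_cl: "\<alpha> \<in> cl \<Upsilon>" "\<alpha>' \<in> cl \<Upsilon>" "\<beta> \<in> cl \<Upsilon>" "\<beta>' \<in> cl \<Upsilon>"
    using assms by (auto simp: misere_equiv_def)
  have "misere_outcome (\<alpha> + \<beta> + \<gamma>) = misere_outcome (\<alpha>' + \<beta>' + \<gamma>)" if \<gamma>: "\<gamma> \<in> cl \<Upsilon>" for \<gamma>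
  proof -
    have "misere_outcome (\<alpha> + (\<beta> + \<gamma>)) = misere_outcome (\<alpha>' + (\<beta> + \<gamma>))"
      using assms(1) in_cl \<gamma> by (auto simp: misere_equiv_def intro: cl.plus)
    moreover have "misere_outcome (\<beta> + (\<alpha>' + \<gamma>)) = misere_outcome (\<beta>' + (\<alpha>' + \<gamma>))"
      using assms(2) in_cl \<gamma> by (auto simp: misere_equiv_def intro: cl.plus)
    ultimately show ?thesis by (simp add: ac_simps)
  qed
  with in_cl show ?thesis by (auto simp: misere_equiv_def intro: cl.plus)
qed

lemma misere_monoid_mult:
  assumes "\<alpha> \<in> cl \<Upsilon>" "\<beta> \<in> cl \<Upsilon>"
  shows "quotient_map (cl \<Upsilon>) \<alpha> \<otimes>\<^bsub>misere_monoid_of (cl \<Upsilon>)\<^esub> quotient_map (cl \<Upsilon>) \<beta> =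
    quotient_map (cl \<Upsilon>) (\<alpha> + \<beta>)"
proof -
  let ?R = "misere_equiv (cl \<Upsilon>)"
  have eq: "quotient_map (cl \<Upsilon>) (\<alpha>' + \<beta>') = quotient_map (cl \<Upsilon>) (\<alpha> + \<beta>)"
    if "(\<alpha>, \<alpha>') \<in> ?R" "(\<beta>, \<beta>') \<in> ?R" for \<alpha>' \<beta>'
    unfolding quotient_map_def
    using equiv_class_eq[OF equiv_misere_equiv misere_equiv_plus[OF that]] by simp
  have "\<alpha> \<in> ?R `` {\<alpha>}" "\<beta> \<in> ?R `` {\<beta>}"
    using assms equiv_class_self[OF equiv_misere_equiv] by blast+
  then have "(\<Union>\<alpha>'\<in>?R `` {\<alpha>}. \<Union>\<beta>'\<in>?R `` {\<beta>}. quotient_map (cl \<Upsilon>) (\<alpha>' + \<beta>')) =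
      (\<Union>\<alpha>'\<in>?R `` {\<alpha>}. \<Union>\<beta>'\<in>?R `` {\<beta>}. quotient_map (cl \<Upsilon>) (\<alpha> + \<beta>))"
    by (intro SUP_cong refl eq) auto
  also have "\<dots> = quotient_map (cl \<Upsilon>) (\<alpha> + \<beta>)"
    using \<open>\<alpha> \<in> ?R `` {\<alpha>}\<close> \<open>\<beta> \<in> ?R `` {\<beta>}\<close> by blast
  finally show ?thesis
    by (simp add: misere_monoid_of_def quotient_map_def)
qed

lemma misere_monoid_label:
  assumes "\<xi> \<in> cl \<Upsilon>"
  shows "outcome_label (misere_monoid_of (cl \<Upsilon>)) (quotient_map (cl \<Upsilon>) \<xi>) = misere_outcome \<xi>"
proof -
  have "misere_outcome \<eta> = misere_outcome \<xi>" if "(\<xi>, \<eta>) \<in> misere_equiv (cl \<Upsilon>)" for \<eta>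
    using that zero_in_cl[OF assms] by (force simp: misere_equiv_def)
  moreover have "\<xi> \<in> misere_equiv (cl \<Upsilon>) `` {\<xi>}"
    using assms equiv_class_self[OF equiv_misere_equiv] by blast
  ultimately have "misere_outcome ` (misere_equiv (cl \<Upsilon>) `` {\<xi>}) = {misere_outcome \<xi>}"
    by blast
  then show ?thesis
    by (simp add: misere_monoid_of_def quotient_map_def)
qed

lemma comm_monoid_misere_monoid_of:
  assumes "\<Upsilon> \<noteq> {}"
  shows "comm_monoid (misere_monoid_of (cl \<Upsilon>))"
proof -
  let ?M = "misere_monoid_of (cl \<Upsilon>)" and ?Q = "quotient_map (cl \<Upsilon>)"
  have 0: "0 \<in> cl \<Upsilon>"
    using assms by (auto intro: zero_in_cl cl.base)
  have carrier: "carrier ?M = ?Q ` cl \<Upsilon>"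
    by (auto simp: misere_monoid_of_def quotient_map_def quotient_def)
  have one: "\<one>\<^bsub>?M\<^esub> = ?Q 0"
    by (simp add: misere_monoid_of_def)
  show ?thesis
    by (rule comm_monoidI)
      (auto simp: carrier one misere_monoid_mult 0 cl.plus ac_simps)
qed

end

theory Submission
  imports Defs
begin

text \<open>Suppose the closure of \<open>\<Upsilon>\<close> has misere monoid \<open>{1, a}\<close>, so that outcomes in it are
  $\mathcal{N}$ or $\mathcal{P}$ and add like parities. Let \<open>\<eta>\<close> be an option of \<open>\<xi>\<close> with the same
  outcome, and take \<open>\<pi>\<close> in the closure with the opposite outcome.
  Then \<open>\<xi> + \<pi>\<close> and its option \<open>\<eta> + \<pi>\<close> are both won by the previous player, which
  is absurd. So every move switches between $\mathcal{N}$ and $\mathcal{P}$, and in a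
  $\mathcal{P}$-position both players can move. These two properties are additive in the parity and
  determine the outcome, no matter from which closures the summands come.\<close>

text \<open>The flag is a parity: \<open>True\<close> will turn out to mean outcome
  \<open>PreviousWins\<close>, \<open>False\<close> outcome \<open>NextWins\<close>. Positions
  without options serve as base case, with flag \<open>False\<close>. A player may lack a move under
  \<open>False\<close>, since being stuck wins in misere play. No closure is mentioned, so that
  summands of different origin can be added.\<close>

inductive alternating :: "bool \<Rightarrow> position \<Rightarrow> bool" where
  alternatingI: "(\<And>p \<eta>. \<eta> |\<in>| opts p \<xi> \<Longrightarrow> alternating (\<not> b) \<eta>) \<Longrightarrow>
    (\<And>p. b \<Longrightarrow> opts p \<xi> \<noteq> {||}) \<Longrightarrow> alternating b \<xi>"

lemma alternating_opts: "alternating b \<xi> \<Longrightarrow> \<eta> |\<in>| opts p \<xi> \<Longrightarrow> alternating (\<not> b) \<eta>"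
  by (auto elim: alternating.cases)

lemma alternating_opts_nonempty: "alternating True \<xi> \<Longrightarrow> opts p \<xi> \<noteq> {||}"
  by (auto elim: alternating.cases)

lemma opts_plus:
  "opts p (\<alpha> + \<beta>) = (\<lambda>\<alpha>'. \<alpha>' + \<beta>) |`| opts p \<alpha> |\<union>| (\<lambda>\<beta>'. \<alpha> + \<beta>') |`| opts p \<beta>"
  by (cases p) (simp_all add: left_opts_plus right_opts_plus)

lemma alternating_zero: "alternating False 0"
proof (rule alternatingI)
  fix p \<eta>
  assume "\<eta> |\<in>| opts p 0"
  then show "alternating (\<not> False) \<eta>"
    by (cases p) (simp_all add: zero_position_def)
qed simp

lemma alternating_star: "alternating True star"
proof (rule alternatingI)
  fix p \<eta>
  assume "\<eta> |\<in>| opts p star"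
  then show "alternating (\<not> True) \<eta>"
    by (cases p) (simp_all add: star_def alternating_zero)
next
  fix p
  show "opts p star \<noteq> {||}"
    by (cases p) (simp_all add: star_def)
qed

text \<open>A move in a sum changes one summand and so flips exactly one of the two flags. If the
  flags differ, one of them is \<open>True\<close>, and that summand gives both players a
  move.\<close>

lemma alternating_plus:
  assumes "alternating b \<alpha>" "alternating c \<beta>"
  shows "alternating (b \<noteq> c) (\<alpha> + \<beta>)"
  using assms
proof (induction "size \<alpha> + size \<beta>" arbitrary: b c \<alpha> \<beta> rule: less_induct)
  case less
  show ?case
  proof (rule alternatingI)
    fix p \<eta>
    assume "\<eta> |\<in>| opts p (\<alpha> + \<beta>)"
    then consider \<alpha>' where "\<alpha>' |\<in>| opts p \<alpha>" "\<eta> = \<alpha>' + \<beta>"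
      | \<beta>' where "\<beta>' |\<in>| opts p \<beta>" "\<eta> = \<alpha> + \<beta>'"
      by (auto simp: opts_plus)
    then show "alternating (\<not> (b \<noteq> c)) \<eta>"
    proof cases
      case 1
      then have "alternating ((\<not> b) \<noteq> c) (\<alpha>' + \<beta>)"
        using less.prems size_opts by (intro less.hyps alternating_opts[of b \<alpha>]) auto
      with 1 show ?thesis by simp
    next
      case 2
      then have "alternating (b \<noteq> (\<not> c)) (\<alpha> + \<beta>')"
        using less.prems size_opts by (intro less.hyps alternating_opts[of c \<beta>]) auto
      with 2 show ?thesis by simp
    qed
  next
    fix p
    assume "b \<noteq> c"
    then have "alternating True \<alpha> \<or> alternating True \<beta>"
      using less.prems by (cases b) auto
    then show "opts p (\<alpha> + \<beta>) \<noteq> {||}"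
      using alternating_opts_nonempty by (auto simp: opts_plus)
  qed
qed

text \<open>With flag \<open>False\<close> the mover is stuck, hence wins, or moves to a position
  with flag \<open>True\<close>, which the opponent loses by induction. With flag
  \<open>True\<close> a move exists and every move hands the opponent a win.\<close>

lemma alternating_wins_first: "alternating b \<xi> \<Longrightarrow> wins_first p \<xi> \<longleftrightarrow> \<not> b"
proof (induction "size \<xi>" arbitrary: b p \<xi> rule: less_induct)
  case less
  have "wins_first q \<eta> \<longleftrightarrow> b" if "\<eta> |\<in>| opts p \<xi>" for q \<eta>
    using less.hyps[OF size_opts[OF that] alternating_opts[OF less.prems that]] by simp
  then show ?case
    using alternating_opts_nonempty[of \<xi> p] less.prems by (subst wins_first.simps) auto
qed

lemma alternating_outcome:
  "alternating b \<xi> \<Longrightarrow> misere_outcome \<xi> = (if b then PreviousWins else NextWins)"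
  by (simp add: misere_outcome_def alternating_wins_first)

lemma PreviousWins_iff: "misere_outcome \<xi> = PreviousWins \<longleftrightarrow> (\<forall>p. \<not> wins_first p \<xi>)"
  unfolding misere_outcome_def by (metis outcome.distinct player.exhaust)

lemma PreviousWins_opts:
  assumes "misere_outcome \<xi> = PreviousWins" "\<eta> |\<in>| opts p \<xi>"
  shows "misere_outcome \<eta> \<noteq> PreviousWins"
  using assms wins_first.simps[of p \<xi>] by (auto simp: PreviousWins_iff)

lemma PreviousWins_opts_nonempty: "misere_outcome \<xi> = PreviousWins \<Longrightarrow> opts p \<xi> \<noteq> {||}"
  using wins_first.simps[of p \<xi>] by (auto simp: PreviousWins_iff)

lemma carrier_misere_monoid_of: "carrier (misere_monoid_of \<Gamma>) = quotient_map \<Gamma> ` \<Gamma>"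
  by (auto simp: misere_monoid_of_def quotient_map_def quotient_def)

lemma cl_star_alternating: "\<xi> \<in> cl {star} \<Longrightarrow> \<exists>b. alternating b \<xi>"
  by (induction rule: cl.induct)
    (auto intro: alternating_star alternating_plus alternating_opts)

lemma cl_star_label_cases:
  assumes "X \<in> carrier (misere_monoid_of (cl {star}))"
  shows "outcome_label (misere_monoid_of (cl {star})) X \<in> {NextWins, PreviousWins}"
proof -
  obtain \<alpha> where \<alpha>: "\<alpha> \<in> cl {star}" "X = quotient_map (cl {star}) \<alpha>"
    using assms by (auto simp: carrier_misere_monoid_of)
  obtain b where "alternating b \<alpha>"
    using \<alpha> cl_star_alternating by blast
  then show ?thesis
    using \<alpha> by (simp add: misere_monoid_label alternating_outcome)
qed

text \<open>The relation \<open>a * a = 1\<close> read on labels: representatives are alternating,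
  and their flags add modulo 2.\<close>

lemma cl_star_label_mult:
  fixes X Y
  defines "M \<equiv> misere_monoid_of (cl {star})"
  assumes "X \<in> carrier M" "Y \<in> carrier M"
  shows "outcome_label M (X \<otimes>\<^bsub>M\<^esub> Y) =
    (if outcome_label M X = outcome_label M Y then NextWins else PreviousWins)"
proof -
  obtain \<alpha> \<beta> where \<alpha>: "\<alpha> \<in> cl {star}" "X = quotient_map (cl {star}) \<alpha>"
    and \<beta>: "\<beta> \<in> cl {star}" "Y = quotient_map (cl {star}) \<beta>"
    using assms by (auto simp: carrier_misere_monoid_of)
  obtain b c where "alternating b \<alpha>" "alternating c \<beta>"
    using \<alpha> \<beta> cl_star_alternating by blast
  with alternating_plus[OF this] show ?thesis
    using \<alpha> \<beta> by (auto simp: M_def misere_monoid_mult misere_monoid_label cl.plus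
        dest!: alternating_outcome split: if_splits)
qed

lemma misere_iso_label:
  assumes "\<phi> \<in> misere_iso (misere_monoid_of (cl \<Upsilon>)) N" "\<xi> \<in> cl \<Upsilon>"
  shows "\<phi> (quotient_map (cl \<Upsilon>) \<xi>) \<in> carrier N"
    and "outcome_label N (\<phi> (quotient_map (cl \<Upsilon>) \<xi>)) = misere_outcome \<xi>"
  using assms
  by (auto simp: misere_iso_def iso_def hom_def carrier_misere_monoid_of misere_monoid_label)

text \<open>The isomorphism preserves products and labels, so the parity rule for labels pulls back
  to outcomes of sums in \<open>cl \<Upsilon>\<close>.\<close>

lemma cl_star_iso_outcome_plus:
  assumes \<phi>: "\<phi> \<in> misere_iso (misere_monoid_of (cl \<Upsilon>)) (misere_monoid_of (cl {star}))"
    and "\<alpha> \<in> cl \<Upsilon>" "\<beta> \<in> cl \<Upsilon>"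
  shows "misere_outcome (\<alpha> + \<beta>) =
    (if misere_outcome \<alpha> = misere_outcome \<beta> then NextWins else PreviousWins)"
proof -
  let ?M = "misere_monoid_of (cl {star})" and ?Q = "quotient_map (cl \<Upsilon>)"
  have "\<phi> (?Q (\<alpha> + \<beta>)) = \<phi> (?Q \<alpha>) \<otimes>\<^bsub>?M\<^esub> \<phi> (?Q \<beta>)"
    using assms
    by (simp add: misere_iso_def iso_def hom_def carrier_misere_monoid_of
        flip: misere_monoid_mult)
  then show ?thesis
    using misere_iso_label[OF \<phi>] assms(2,3) cl.plus[OF assms(2,3)]
    by (metis cl_star_label_mult)
qed

text \<open>By surjectivity of \<open>\<phi>\<close>, some class is sent to the class of
  \<open>star\<close>; any representative of it has the outcome of \<open>star\<close>.\<close>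

lemma cl_star_iso_PreviousWins:
  assumes \<phi>: "\<phi> \<in> misere_iso (misere_monoid_of (cl \<Upsilon>)) (misere_monoid_of (cl {star}))"
  obtains \<pi> where "\<pi> \<in> cl \<Upsilon>" "misere_outcome \<pi> = PreviousWins"
proof -
  let ?M = "misere_monoid_of (cl {star})" and ?S = "quotient_map (cl {star}) star"
  have star: "star \<in> cl {star}"
    by (simp add: cl.base)
  then have "?S \<in> \<phi> ` carrier (misere_monoid_of (cl \<Upsilon>))"
    using \<phi> by (auto simp: misere_iso_def iso_def bij_betw_def carrier_misere_monoid_of)
  then obtain \<pi> where \<pi>: "\<pi> \<in> cl \<Upsilon>" "?S = \<phi> (quotient_map (cl \<Upsilon>) \<pi>)"
    by (auto simp: carrier_misere_monoid_of)
  then have "misere_outcome \<pi> = misere_outcome star"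
    using misere_iso_label(2)[OF \<phi>] misere_monoid_label[OF star] by metis
  then show thesis
    using that \<pi> alternating_outcome[OF alternating_star] by simp
qed

lemma cl_star_iso_alternating:
  assumes \<phi>: "\<phi> \<in> misere_iso (misere_monoid_of (cl \<Upsilon>)) (misere_monoid_of (cl {star}))"
    and "\<xi> \<in> cl \<Upsilon>"
  shows "alternating (misere_outcome \<xi> = PreviousWins) \<xi>"
  using assms(2)
proof (induction "size \<xi>" arbitrary: \<xi> rule: less_induct)
  case less
  have NP: "misere_outcome \<alpha> \<in> {NextWins, PreviousWins}" if "\<alpha> \<in> cl \<Upsilon>" for \<alpha>
    using misere_iso_label[OF \<phi> that] cl_star_label_cases by metis
  show ?case
  proof (rule alternatingI)
    fix p \<eta>
    assume \<eta>: "\<eta> |\<in>| opts p \<xi>"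
    then have \<eta>_cl: "\<eta> \<in> cl \<Upsilon>"
      using less.prems cl.opts by blast
    have "misere_outcome \<eta> \<noteq> misere_outcome \<xi>"
    proof
      assume eq: "misere_outcome \<eta> = misere_outcome \<xi>"
      \<comment> \<open>If \<open>\<xi>\<close> has outcome \<open>PreviousWins\<close>, take
        \<open>0\<close>, which the next player wins; otherwise take a position supplied by
        \<open>cl_star_iso_PreviousWins\<close>.\<close>
      obtain \<pi> where \<pi>: "\<pi> \<in> cl \<Upsilon>" "misere_outcome \<pi> \<noteq> misere_outcome \<xi>"
        using cl_star_iso_PreviousWins[OF \<phi>] zero_in_cl[OF less.prems]
          alternating_outcome[OF alternating_zero] by (metis outcome.distinct)
      have "misere_outcome (\<xi> + \<pi>) = PreviousWins" "misere_outcome (\<eta> + \<pi>) = PreviousWins"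
        using \<pi> eq \<eta>_cl less.prems by (auto simp: cl_star_iso_outcome_plus[OF \<phi>])
      moreover have "\<eta> + \<pi> |\<in>| opts p (\<xi> + \<pi>)"
        using \<eta> by (auto simp: opts_plus)
      ultimately show False
        using PreviousWins_opts by blast
    qed
    \<comment> \<open>Only two outcomes occur in \<open>cl \<Upsilon>\<close>, so unequal outcomes
      mean opposite flags.\<close>
    then have "(misere_outcome \<eta> = PreviousWins) = (\<not> misere_outcome \<xi> = PreviousWins)"
      using NP[OF \<eta>_cl] NP[OF less.prems] by auto
    then show "alternating (\<not> misere_outcome \<xi> = PreviousWins) \<eta>"
      using less.hyps[OF size_opts[OF \<eta>] \<eta>_cl] by simp
  qed (rule PreviousWins_opts_nonempty)
qed

theorem theorem7p3p3:
  fixes \<Upsilon>\<^sub>1 \<Upsilon>\<^sub>2 :: "position set"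
    and \<phi>\<^sub>1 \<phi>\<^sub>2 :: "position set \<Rightarrow> position set"
    and \<xi>\<^sub>1 \<xi>\<^sub>2 :: position
  assumes "misere_isomorphic (misere_monoid_of (cl \<Upsilon>\<^sub>1)) (misere_monoid_of (cl \<Upsilon>\<^sub>2))"
    and "misere_isomorphic (misere_monoid_of (cl \<Upsilon>\<^sub>2)) (misere_monoid_of (cl {star}))"
    and "\<phi>\<^sub>1 \<in> misere_iso (misere_monoid_of (cl \<Upsilon>\<^sub>1)) (misere_monoid_of (cl {star}))"
    and "\<phi>\<^sub>2 \<in> misere_iso (misere_monoid_of (cl \<Upsilon>\<^sub>2)) (misere_monoid_of (cl {star}))"
    and "\<xi>\<^sub>1 \<in> cl \<Upsilon>\<^sub>1" and "\<xi>\<^sub>2 \<in> cl \<Upsilon>\<^sub>2"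
  shows "misere_outcome (\<xi>\<^sub>1 + \<xi>\<^sub>2) \<in> {NextWins, PreviousWins}
    \<and> misere_outcome (\<xi>\<^sub>1 + \<xi>\<^sub>2) =
        outcome_label (misere_monoid_of (cl {star}))
          (\<phi>\<^sub>1 (quotient_map (cl \<Upsilon>\<^sub>1) \<xi>\<^sub>1)
             \<otimes>\<^bsub>misere_monoid_of (cl {star})\<^esub>
           \<phi>\<^sub>2 (quotient_map (cl \<Upsilon>\<^sub>2) \<xi>\<^sub>2))"
proof -
  let ?M = "misere_monoid_of (cl {star})"
  note \<phi>\<^sub>1 = assms(3) and \<phi>\<^sub>2 = assms(4) and \<xi>\<^sub>1 = assms(5) and \<xi>\<^sub>2 = assms(6)
  let ?x = "\<phi>\<^sub>1 (quotient_map (cl \<Upsilon>\<^sub>1) \<xi>\<^sub>1)" and ?y = "\<phi>\<^sub>2 (quotient_map (cl \<Upsilon>\<^sub>2) \<xi>\<^sub>2)"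
  have alt: "alternating (misere_outcome \<xi>\<^sub>1 = PreviousWins) \<xi>\<^sub>1"
    "alternating (misere_outcome \<xi>\<^sub>2 = PreviousWins) \<xi>\<^sub>2"
    using cl_star_iso_alternating \<phi>\<^sub>1 \<phi>\<^sub>2 \<xi>\<^sub>1 \<xi>\<^sub>2 by blast+
  have "misere_outcome (\<xi>\<^sub>1 + \<xi>\<^sub>2) =
      (if misere_outcome \<xi>\<^sub>1 = misere_outcome \<xi>\<^sub>2 then NextWins else PreviousWins)"
    \<comment> \<open>The second fact limits both outcomes to two values, so the flags agree exactly
      when the outcomes do.\<close>
    using alternating_outcome[OF alternating_plus[OF alt]] alt[THEN alternating_outcome]
    by (auto split: if_splits)
  moreover have "outcome_label ?M (?x \<otimes>\<^bsub>?M\<^esub> ?y) =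
      (if misere_outcome \<xi>\<^sub>1 = misere_outcome \<xi>\<^sub>2 then NextWins else PreviousWins)"
    using cl_star_label_mult[of ?x ?y] misere_iso_label[OF \<phi>\<^sub>1 \<xi>\<^sub>1] misere_iso_label[OF \<phi>\<^sub>2 \<xi>\<^sub>2]
    by simp
  ultimately show ?thesis
    by simp
qed

end
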